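(* Let $X\in\mathbb{R}^{m\times m}$ be symmetric, $a_1,b_1,a_2,\varepsilon_1,\varepsilon_2>0$, and define on $\mathbb{R}^{m\times r}\times\mathbb{R}^{r\times r}$ $$f(U,V)=\tfrac12\|X-UVU^T\|_F^2,\quad h_1(U,V)=\tfrac{a_1}{4}\|V\|_F^2\|U\|_F^4+\tfrac{b_1}{2}(\|X\|_F\|V\|_F+\varepsilon_1)\|U\|_F^2,\quad h_2(U,V)=\tfrac{a_2}{2}(\|U\|_F^4+\varepsilon_2)\|V\|_F^2.$$ Let $U^k,U^{k-1}\in\mathbb{R}^{m\times r}$, $V^k,V^{k-1}\in\mathbb{R}^{r\times r}$, $\gamma_1^k,\gamma_2^k>0$ and $\alpha_1^k,\alpha_2^k\ge0$ be given. (i) The solution $U^{k+1}$ of $$\min_{U\ge0}\ \left\langle\nabla_Uf(U^k,V^k)-\tfrac{\alpha_1^k}{\gamma_1^k}(U^k-U^{k-1}),U-U^k\right\rangle+\tfrac1{\gamma_1^k}D_{h_1}\big((U,V^k),(U^k,V^k)\big)$$ is $$U^{k+1}=\tfrac1{t_k}\max\{G^k,0\},\qquad G^k:=\nabla_Uh_1(U^k,V^k)-\gamma_1^k\nabla_Uf(U^k,V^k)+\alpha_1^k(U^k-U^{k-1}),$$ where $$\nabla_Uf(U^k,V^k)=-XU^k(V^k)^T-X^TU^kV^k+U^kV^k(U^k)^TU^k(V^k)^T+U^k(V^k)^T(U^k)^TU^kV^k,$$ $$\nabla_Uh_1(U^k,V^k)=\left(a_1\|U^k\|_F^2\|V^k\|_F^2+b_1(\|X\|_F\|V^k\|_F+\varepsilon_1)\right)U^k,$$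 $$t_k=\frac{\tau_1}{3}+\sqrt[3]{\frac{\tau_2+\sqrt{\Delta_1}}{2}+\frac{\tau_1^3}{27}}+\sqrt[3]{\frac{\tau_2-\sqrt{\Delta_1}}{2}+\frac{\tau_1^3}{27}},$$ with $\tau_1=b_1(\|X\|_F\|V^k\|_F+\varepsilon_1)$, $\tau_2=a_1\|V^k\|_F^2\,\|\max\{G^k,0\}\|_F^2$ and $\Delta_1=\tau_2^2+\frac{4}{27}\tau_2\tau_1^3$. (ii) With $\eta_k:=a_2(\|U^{k+1}\|_F^4+\varepsilon_2)$, the solution $V^{k+1}$ of $$\min_{V\ge0}\ \left\langle\nabla_Vf(U^{k+1},V^k)-\tfrac{\alpha_2^k}{\gamma_2^k}(V^k-V^{k-1}),V-V^k\right\rangle+\tfrac1{\gamma_2^k}D_{h_2}\big((U^{k+1},V),(U^{k+1},V^k)\big)$$ is $$V^{k+1}=\max\left\{V^k+\tfrac1{\eta_k}\Big(\alpha_2^k(V^k-V^{k-1})-\gamma_2^k\nabla_Vf(U^{k+1},V^k)\Big),0\right\},$$ where $\nabla_Vf(U^{k+1},V^k)=-(U^{k+1})^TXU^{k+1}+(U^{k+1})^TU^{k+1}V^k(U^{k+1})^TU^{k+1}$.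
   Context: $\|\cdot\|_F$ is the Frobenius norm, $\langle A,B\rangle=\mathrm{tr}(A^TB)$, $\max\{\cdot,0\}$ and the constraints $U\ge0$, $V\ge0$ are entrywise, and $\sqrt[3]{\cdot}$ is the real cube root. The block Bregman distances are $$D_{h_1}\big((U,V^k),(U^k,V^k)\big)=h_1(U,V^k)-h_1(U^k,V^k)-\langle\nabla_Uh_1(U^k,V^k),U-U^k\rangle,$$ $$D_{h_2}\big((U^{k+1},V),(U^{k+1},V^k)\big)=h_2(U^{k+1},V)-h_2(U^{k+1},V^k)-\langle\nabla_Vh_2(U^{k+1},V^k),V-V^k\rangle.$$ These two problems are the subproblems of the block inertial Bregman proximal algorithm applied to $\min_{U\ge0,V\ge0}\frac12\|X-UVU^T\|_F^2$ with the two blocks $U$ and $V$, stepsizes $\gamma_i^k$ and inertial parameters $\alpha_i^k$. *)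

theory Defs
  imports "HOL-Analysis.Analysis"
begin

text \<open>
  Real $m \times r$ matrices are \<^typ>\<open>real ^ 'r ^ 'm\<close>. On this type the library's \<^const>\<open>norm\<close>,
  \<^const>\<open>inner\<close> and \<open>\<le>\<close> are the Frobenius norm, the trace inner product and the entrywise order;
  the following facts record this.
\<close>

lemma inner_eq_trace:
  fixes A B :: "real ^ 'r ^ 'm"
  shows "A \<bullet> B = trace (transpose A ** B)"
proof -
  have "A \<bullet> B = (\<Sum>i\<in>UNIV. \<Sum>j\<in>UNIV. A $ i $ j * B $ i $ j)"
    by (simp add: inner_vec_def)
  also have "\<dots> = (\<Sum>j\<in>UNIV. \<Sum>i\<in>UNIV. A $ i $ j * B $ i $ j)"
    by (rule sum.swap)
  also have "\<dots> = trace (transpose A ** B)"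
    by (simp add: trace_def transpose_def matrix_matrix_mult_def)
  finally show ?thesis .
qed

lemma norm_eq_frobenius:
  fixes A :: "real ^ 'r ^ 'm"
  shows "norm A = sqrt (\<Sum>i\<in>UNIV. \<Sum>j\<in>UNIV. (A $ i $ j)\<^sup>2)"
  by (simp add: norm_eq_sqrt_inner inner_vec_def power2_eq_square)

lemma nonneg_iff_entrywise:
  fixes A :: "real ^ 'r ^ 'm"
  shows "0 \<le> A \<longleftrightarrow> (\<forall>i j. 0 \<le> A $ i $ j)"
  by (simp add: less_eq_vec_def)

definition mat_max0 :: "real ^ 'r ^ 'm \<Rightarrow> real ^ 'r ^ 'm" where
  "mat_max0 A = (\<chi> i j. max (A $ i $ j) 0)"

definition grad :: "('a::real_inner \<Rightarrow> real) \<Rightarrow> 'a \<Rightarrow> 'a" where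
  "grad F x = (THE D. GDERIV F x :> D)"

lemma grad_eqI:
  assumes "GDERIV F x :> D"
  shows "grad F x = D"
  unfolding grad_def
proof (rule the_equality)
  fix D' assume "GDERIV F x :> D'"
  with assms have "(\<lambda>h. h \<bullet> D') = (\<lambda>h. h \<bullet> D)"
    unfolding gderiv_def by (metis has_derivative_unique)
  then have "(D' - D) \<bullet> D' = (D' - D) \<bullet> D" by metis
  then have "(D' - D) \<bullet> (D' - D) = 0" by (simp add: inner_diff_right)
  then show "D' = D" by simp
qed (rule assms)

definition gradU :: "('a::real_inner \<Rightarrow> 'b \<Rightarrow> real) \<Rightarrow> 'a \<Rightarrow> 'b \<Rightarrow> 'a" where
  "gradU F U V = grad (\<lambda>U'. F U' V) U"

definition gradV :: "('a \<Rightarrow> 'b::real_inner \<Rightarrow> real) \<Rightarrow> 'a \<Rightarrow> 'b \<Rightarrow> 'b" where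
  "gradV F U V = grad (\<lambda>V'. F U V') V"

text \<open>\<open>breg_distU h U U\<^sub>0 V\<close> is $D_h((U,V),(U_0,V))$ and \<open>breg_distV h U V V\<^sub>0\<close> is $D_h((U,V),(U,V_0))$.\<close>

definition breg_distU :: "('a::real_inner \<Rightarrow> 'b \<Rightarrow> real) \<Rightarrow> 'a \<Rightarrow> 'a \<Rightarrow> 'b \<Rightarrow> real" where
  "breg_distU h U U\<^sub>0 V = h U V - h U\<^sub>0 V - gradU h U\<^sub>0 V \<bullet> (U - U\<^sub>0)"

definition breg_distV :: "('a \<Rightarrow> 'b::real_inner \<Rightarrow> real) \<Rightarrow> 'a \<Rightarrow> 'b \<Rightarrow> 'b \<Rightarrow> real" where
  "breg_distV h U V V\<^sub>0 = h U V - h U V\<^sub>0 - gradV h U V\<^sub>0 \<bullet> (V - V\<^sub>0)"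

definition tri_fact_loss :: "real ^ 'm ^ 'm \<Rightarrow> real ^ 'r ^ 'm \<Rightarrow> real ^ 'r ^ 'r \<Rightarrow> real" where
  "tri_fact_loss X U V = (1/2) * (norm (X - U ** V ** transpose U))\<^sup>2"

definition kernel1 ::
    "real \<Rightarrow> real \<Rightarrow> real \<Rightarrow> real ^ 'm ^ 'm \<Rightarrow> real ^ 'r ^ 'm \<Rightarrow> real ^ 'r ^ 'r \<Rightarrow> real" where
  "kernel1 a b \<epsilon> X U V =
     (a/4) * (norm V)^2 * (norm U)^4 + (b/2) * (norm X * norm V + \<epsilon>) * (norm U)^2"

definition kernel2 :: "real \<Rightarrow> real \<Rightarrow> real ^ 'r ^ 'm \<Rightarrow> real ^ 'r ^ 'r \<Rightarrow> real" where
  "kernel2 a \<epsilon> U V = (a/2) * ((norm U)^4 + \<epsilon>) * (norm V)^2"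

text \<open>
  The objectives of the two block subproblems with stepsize \<open>\<gamma>\<close> and inertial parameter \<open>\<alpha>\<close>;
  \<open>Uk\<close>, \<open>Vk\<close> are the current and \<open>Up\<close>, \<open>Vp\<close> the previous iterates, and the last
  argument is the optimization variable.
\<close>

definition subproblemU ::
    "('a::real_inner \<Rightarrow> 'b \<Rightarrow> real) \<Rightarrow> ('a \<Rightarrow> 'b \<Rightarrow> real) \<Rightarrow> real \<Rightarrow> real \<Rightarrow> 'a \<Rightarrow> 'a \<Rightarrow> 'b \<Rightarrow> 'a \<Rightarrow> real" where
  "subproblemU f h \<gamma> \<alpha> Uk Up Vk U =
     (gradU f Uk Vk - (\<alpha>/\<gamma>) *\<^sub>R (Uk - Up)) \<bullet> (U - Uk) + (1/\<gamma>) * breg_distU h U Uk Vk"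

definition subproblemV ::
    "('a \<Rightarrow> 'b::real_inner \<Rightarrow> real) \<Rightarrow> ('a \<Rightarrow> 'b \<Rightarrow> real) \<Rightarrow> real \<Rightarrow> real \<Rightarrow> 'a \<Rightarrow> 'b \<Rightarrow> 'b \<Rightarrow> 'b \<Rightarrow> real" where
  "subproblemV f h \<gamma> \<alpha> U Vk Vp V =
     (gradV f U Vk - (\<alpha>/\<gamma>) *\<^sub>R (Vk - Vp)) \<bullet> (V - Vk) + (1/\<gamma>) * breg_distV h U V Vk"

end

theory Submission
  imports Defs
begin

text \<open>
  Up to a positive factor and a constant, both subproblems minimize
  $\varphi(U) = \frac A4\|U\|^4 + \frac B2\|U\|^2 - \langle G,U\rangle$ over $U \ge 0$, with $A = 0$
  in the second one. If $t > 0$ and $P = \max\{G,0\}$ satisfy $t = A\|P/t\|^2 + B$, then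
  $U^* = P/t$ fulfils $\langle G,U\rangle \le \langle P,U\rangle$ for $U \ge 0$, with equality at
  $U^*$, and convexity of $s \mapsto s^2$ gives
  $\varphi(U) \ge \varphi(U^*) + \frac t2\|U-U^*\|^2$. So $U^*$ is the only minimizer. The
  condition on $t$ is the cubic $t^3 = Bt^2 + A\|P\|^2$, which is solved by Cardano's formula.
\<close>

section \<open>Adjoint and differentiation rules for matrix products and transposes\<close>

lemma inner_matrix_mult_left:
  fixes A :: "real ^ 'n ^ 'm" and B :: "real ^ 'k ^ 'n" and C :: "real ^ 'k ^ 'm"
  shows "(A ** B) \<bullet> C = B \<bullet> (transpose A ** C)"
  by (simp add: inner_eq_trace matrix_transpose_mul matrix_mul_assoc)

lemma inner_transpose:
  fixes A :: "real ^ 'n ^ 'm"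
  shows "transpose A \<bullet> B = A \<bullet> transpose B"
proof -
  have "transpose A \<bullet> B = (\<Sum>i\<in>UNIV. \<Sum>j\<in>UNIV. A $ j $ i * B $ i $ j)"
    by (simp add: inner_vec_def transpose_def)
  also have "\<dots> = (\<Sum>j\<in>UNIV. \<Sum>i\<in>UNIV. A $ j $ i * B $ i $ j)"
    by (rule sum.swap)
  finally show ?thesis
    by (simp add: inner_vec_def transpose_def)
qed

text \<open>Transposing both arguments preserves the trace inner product and turns right
  multiplication into left multiplication.\<close>

lemma inner_matrix_mult_right:
  fixes A :: "real ^ 'n ^ 'm" and B :: "real ^ 'k ^ 'n" and C :: "real ^ 'k ^ 'm"
  shows "(A ** B) \<bullet> C = A \<bullet> (C ** transpose B)"
proof -
  have "(A ** B) \<bullet> C = transpose (A ** B) \<bullet> transpose C"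
    by (simp add: inner_transpose)
  also have "\<dots> = transpose A \<bullet> transpose (C ** transpose B)"
    by (simp add: matrix_transpose_mul inner_matrix_mult_left)
  finally show ?thesis
    by (simp add: inner_transpose)
qed

lemma bounded_bilinear_matrix_matrix_mult:
  "bounded_bilinear ((**) :: real ^ 'n ^ 'm \<Rightarrow> real ^ 'k ^ 'n \<Rightarrow> real ^ 'k ^ 'm)"
  unfolding bilinear_conv_bounded_bilinear[symmetric] bilinear_def
  by (auto intro!: linearI simp: matrix_add_ldistrib matrix_scalar_ac scalar_matrix_assoc
      matrix_matrix_mult_def vec_eq_iff sum.distrib algebra_simps sum_distrib_left)

lemmas has_derivative_matrix_mult [derivative_intros] =
  bounded_bilinear.FDERIV[OF bounded_bilinear_matrix_matrix_mult]

lemma bounded_linear_transpose: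
  "bounded_linear (transpose :: real ^ 'n ^ 'm \<Rightarrow> real ^ 'm ^ 'n)"
  unfolding linear_conv_bounded_linear[symmetric]
  by (auto intro!: linearI simp: transpose_def vec_eq_iff)

lemmas has_derivative_transpose [derivative_intros] =
  bounded_linear.has_derivative[OF bounded_linear_transpose]

interpretation matrix_mult: bounded_bilinear
  "(**) :: real ^ 'n ^ 'm \<Rightarrow> real ^ 'k ^ 'n \<Rightarrow> real ^ 'k ^ 'm"
  by (rule bounded_bilinear_matrix_matrix_mult)

section \<open>Gradients of the loss and of the two kernels\<close>

lemma has_derivative_half_norm_power2:
  fixes F :: "'a::real_normed_vector \<Rightarrow> 'b::real_inner"
  assumes "(F has_derivative F') (at x)"
  shows "((\<lambda>x. (1/2) * (norm (F x))\<^sup>2) has_derivative (\<lambda>h. F' h \<bullet> F x)) (at x)"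
  unfolding power2_norm_eq_inner
  by (rule has_derivative_eq_rhs, (rule derivative_eq_intros assms refl)+)
    (simp add: fun_eq_iff inner_commute)

text \<open>With residual \<open>R\<close>, the two occurrences of \<open>U\<close> give two terms
  in the differential. The adjoint rules move every factor off the direction \<open>H\<close>, and
  what remains paired with \<open>H\<close> is the gradient.\<close>

lemma GDERIV_tri_fact_loss_U:
  fixes X :: "real ^ 'm ^ 'm" and U :: "real ^ 'r ^ 'm" and V :: "real ^ 'r ^ 'r"
  shows "GDERIV (\<lambda>U. tri_fact_loss X U V) U :>
    - (X ** U ** transpose V) - transpose X ** U ** V
    + U ** V ** transpose U ** U ** transpose V
    + U ** transpose V ** transpose U ** U ** V"
proof -
  define R where "R = X - U ** V ** transpose U"
  have "((\<lambda>U. X - U ** V ** transpose U) has_derivative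
      (\<lambda>H. - (U ** V ** transpose H + H ** V ** transpose U))) (at U)"
    by (auto intro!: derivative_eq_intros simp: matrix_mult.zero_right)
  then have "((\<lambda>U. tri_fact_loss X U V) has_derivative
      (\<lambda>H. - (U ** V ** transpose H + H ** V ** transpose U) \<bullet> R)) (at U)"
    unfolding tri_fact_loss_def R_def by (rule has_derivative_half_norm_power2)
  moreover have "- (U ** V ** transpose H + H ** V ** transpose U) \<bullet> R =
      H \<bullet> (- (transpose R ** (U ** V)) - R ** U ** transpose V)" for H
  proof -
    have "(U ** V ** transpose H) \<bullet> R = H \<bullet> (transpose R ** (U ** V))"
      by (simp only: inner_matrix_mult_left inner_transpose matrix_transpose_mul
          transpose_transpose)
    moreover have "(H ** V ** transpose U) \<bullet> R = H \<bullet> (R ** U ** transpose V)"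
      by (simp only: inner_matrix_mult_right transpose_transpose)
    ultimately show ?thesis
      by (simp only: inner_minus_left inner_add_left inner_diff_right inner_minus_right)
  qed
  ultimately have "GDERIV (\<lambda>U. tri_fact_loss X U V) U :>
      - (transpose R ** (U ** V)) - R ** U ** transpose V"
    by (simp only: gderiv_def)
  moreover have "transpose R = transpose X - U ** transpose V ** transpose U"
    using linear_diff[OF bounded_linear.linear[OF bounded_linear_transpose], of X "U ** V ** transpose U"]
    by (simp add: R_def matrix_transpose_mul matrix_mul_assoc)
  ultimately show ?thesis
    by (elim GDERIV_subst) (simp add: R_def matrix_mult.diff_left matrix_mul_assoc)
qed

lemma GDERIV_tri_fact_loss_V:
  fixes X :: "real ^ 'm ^ 'm" and U :: "real ^ 'r ^ 'm" and V :: "real ^ 'r ^ 'r"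
  shows "GDERIV (\<lambda>V. tri_fact_loss X U V) V :>
    - (transpose U ** X ** U) + transpose U ** U ** V ** transpose U ** U"
proof -
  define R where "R = X - U ** V ** transpose U"
  have "((\<lambda>V. X - U ** V ** transpose U) has_derivative
      (\<lambda>H. - (U ** H ** transpose U))) (at V)"
    by (auto intro!: derivative_eq_intros simp: matrix_mult.zero_right matrix_mult.zero_left)
  then have "((\<lambda>V. tri_fact_loss X U V) has_derivative
      (\<lambda>H. - (U ** H ** transpose U) \<bullet> R)) (at V)"
    unfolding tri_fact_loss_def R_def by (rule has_derivative_half_norm_power2)
  moreover have "- (U ** H ** transpose U) \<bullet> R = H \<bullet> - (transpose U ** (R ** U))" for H
    by (simp only: inner_minus_left inner_minus_right
        inner_matrix_mult_right[of "U ** H"] inner_matrix_mult_left[of U H] transpose_transpose)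
  ultimately have "GDERIV (\<lambda>V. tri_fact_loss X U V) V :> - (transpose U ** (R ** U))"
    by (simp only: gderiv_def)
  then show ?thesis
    by (rule GDERIV_subst)
      (simp add: R_def matrix_mult.diff_left matrix_mult.diff_right matrix_mul_assoc)
qed

text \<open>Covers both kernels: \<open>kernel1\<close> has this form in \<open>U\<close>, and
  \<open>kernel2\<close> has it in \<open>V\<close> with \<open>A = 0\<close>.\<close>

lemma GDERIV_norm_quartic:
  fixes x :: "'a::real_inner"
  shows "GDERIV (\<lambda>x. (A/4) * norm x ^ 4 + (B/2) * (norm x)\<^sup>2) x :>
    (A * (norm x)\<^sup>2 + B) *\<^sub>R x"
proof -
  \<comment> \<open>As a polynomial in \<open>y \<bullet> y\<close> the function is visibly
    differentiable at 0 too, where the norm itself is not.\<close>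
  have norm4: "norm y ^ 4 = (y \<bullet> y)\<^sup>2" for y :: 'a
    by (metis numeral_Bit0 power2_norm_eq_inner power_mult mult_2)
  show ?thesis
    unfolding gderiv_def norm4 power2_norm_eq_inner
    by (rule has_derivative_eq_rhs, (rule derivative_eq_intros refl)+)
      (simp add: fun_eq_iff inner_commute algebra_simps power2_eq_square)
qed

lemma GDERIV_kernel1:
  "GDERIV (\<lambda>U. kernel1 a b \<epsilon> X U V) U :>
    (a * (norm U)\<^sup>2 * (norm V)\<^sup>2 + b * (norm X * norm V + \<epsilon>)) *\<^sub>R U"
  using GDERIV_norm_quartic[of "a * (norm V)\<^sup>2" "b * (norm X * norm V + \<epsilon>)" U]
  by (simp add: kernel1_def mult_ac)

lemma GDERIV_kernel2:
  "GDERIV (\<lambda>V. kernel2 a \<epsilon> U V) V :> (a * (norm U ^ 4 + \<epsilon>)) *\<^sub>R V"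
  using GDERIV_norm_quartic[of 0 "a * (norm U ^ 4 + \<epsilon>)" V]
  by (simp add: kernel2_def mult_ac)

text \<open>Putting \<open>t = p/3 + y\<close> removes the quadratic term:
  \<open>y^3 = (p^2/3) * y + q + 2*p^3/27\<close>. This holds for \<open>y = s + w\<close> once
  \<open>3*s*w = p^2/3\<close> and \<open>s^3 + w^3 = q + 2*p^3/27\<close>.\<close>

lemma cardano_cubic_root:
  fixes p q :: real
  assumes "p > 0" "q \<ge> 0"
  defines "D \<equiv> q\<^sup>2 + (4/27) * q * p ^ 3"
  defines "t \<equiv> p/3 + root 3 ((q + sqrt D)/2 + p ^ 3/27) + root 3 ((q - sqrt D)/2 + p ^ 3/27)"
  shows "t > 0" "t ^ 3 = p * t\<^sup>2 + q"
proof -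
  define d where "d = sqrt D"
  define s where "s = root 3 ((q + d)/2 + p ^ 3/27)"
  define w where "w = root 3 ((q - d)/2 + p ^ 3/27)"
  have "D \<ge> 0" using assms by (simp add: D_def)
  then have d: "d\<^sup>2 = D" "d \<ge> 0" by (simp_all add: d_def)
  have s3: "s ^ 3 = (q + d)/2 + p ^ 3/27" and w3: "w ^ 3 = (q - d)/2 + p ^ 3/27"
    by (simp_all add: s_def w_def odd_real_root_pow)
  \<comment> \<open>\<open>D\<close> is the value that makes the product of the two radicands a
    perfect cube.\<close>
  have "((q + d)/2 + p ^ 3/27) * ((q - d)/2 + p ^ 3/27)
      = (q/2 + p ^ 3/27)\<^sup>2 - (d)\<^sup>2 / 4"
    by (simp add: field_simps power2_eq_square)
  also have "\<dots> = (p\<^sup>2/9) ^ 3"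
    unfolding d D_def by (simp add: field_simps power2_eq_square power3_eq_cube)
  finally have "s * w = root 3 ((p\<^sup>2/9) ^ 3)"
    by (simp add: s_def w_def real_root_mult[symmetric])
  then have sw: "s * w = p\<^sup>2/9"
    by (simp add: odd_real_root_power_cancel)
  have "(q + d)/2 + p ^ 3/27 > 0"
    using assms d by (intro add_nonneg_pos) auto
  then have "s > 0" by (simp add: s_def)
  \<comment> \<open>Since \<open>d \<ge> q\<close>, the radicand of \<open>w\<close> has no evident
    sign; the sign of \<open>w\<close> comes from that of the product.\<close>
  moreover have "s * w > 0" unfolding sw using \<open>p > 0\<close> by simp
  ultimately have "w > 0" by (simp add: zero_less_mult_iff)
  have t: "t = p/3 + s + w" by (simp add: t_def s_def w_def d_def)
  show "t > 0" using \<open>p > 0\<close> \<open>s > 0\<close> \<open>w > 0\<close> by (simp add: t)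
  \<comment> \<open>The coefficient of \<open>s + w\<close> vanishes by the value of
    \<open>s * w\<close>.\<close>
  have "t ^ 3 - p * t\<^sup>2 = (s ^ 3 + w ^ 3) + (3 * (s * w) - p\<^sup>2/3) * (s + w) - 2 * p ^ 3/27"
    by (simp add: t field_simps power2_eq_square power3_eq_cube)
  also have "\<dots> = q" by (simp add: s3 w3 sw field_simps)
  finally show "t ^ 3 = p * t\<^sup>2 + q" by simp
qed

text \<open>Growth gives minimality of \<open>x\<close>, and also uniqueness: a minimizer
  \<open>y\<close> satisfies \<open>c * (norm (y - x))^2 \<le> 0\<close>.\<close>

lemma is_arg_min_iff_quadratic_growth:
  fixes F :: "'a::real_normed_vector \<Rightarrow> real"
  assumes "P x" "c > 0" "\<And>y. P y \<Longrightarrow> F y \<ge> F x + c * (norm (y - x))\<^sup>2"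
  shows "is_arg_min F P y \<longleftrightarrow> y = x"
proof
  assume y: "is_arg_min F P y"
  then have "F x + c * (norm (y - x))\<^sup>2 \<le> F x"
    using assms by (force simp: is_arg_min_linorder)
  then have "c * (norm (y - x))\<^sup>2 \<le> 0" by simp
  then show "y = x"
    using \<open>c > 0\<close> by (simp add: mult_le_0_iff)
next
  have "c * (norm (z - x))\<^sup>2 \<ge> 0" for z using \<open>c > 0\<close> by simp
  then have "F x \<le> F z" if "P z" for z
    using assms(3)[OF that] by (smt (verit))
  then show "y = x \<Longrightarrow> is_arg_min F P y"
    using \<open>P x\<close> by (simp add: is_arg_min_linorder)
qed

lemma is_arg_min_affine:
  fixes F :: "'a \<Rightarrow> real"
  assumes "\<And>x. H x = c * F x + d" "c > 0"
  shows "is_arg_min H P x \<longleftrightarrow> is_arg_min F P x"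
  using assms by (simp add: is_arg_min_linorder)

section \<open>The entrywise positive part and the model problem on the nonnegative orthant\<close>

lemma mat_max0_nonneg: "0 \<le> mat_max0 G"
  by (simp add: nonneg_iff_entrywise mat_max0_def)

lemma mat_max0_scaleR:
  assumes "c \<ge> 0"
  shows "mat_max0 (c *\<^sub>R A) = c *\<^sub>R mat_max0 A"
  using assms by (simp add: mat_max0_def vec_eq_iff max_mult_distrib_left)

lemma inner_le_inner_mat_max0:
  assumes "0 \<le> U"
  shows "G \<bullet> U \<le> mat_max0 G \<bullet> U"
  using assms unfolding nonneg_iff_entrywise
  by (auto simp: inner_vec_def mat_max0_def intro!: sum_mono mult_right_mono)

text \<open>Each entry of the positive part is either 0 or the entry of \<open>G\<close>. Hence
  \<open>inner_le_inner_mat_max0\<close> is an equality at nonnegative multiples of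
  \<open>mat_max0 G\<close>.\<close>

lemma inner_mat_max0_self: "G \<bullet> mat_max0 G = mat_max0 G \<bullet> mat_max0 G"
  by (auto simp: inner_vec_def mat_max0_def max_def intro!: sum.cong)

text \<open>The hypothesis on \<open>t\<close> is stationarity: at
  \<open>S = (1/t) *\<^sub>R mat_max0 G\<close> the gradient
  \<open>(A * (norm S)^2 + B) *\<^sub>R S\<close> of the norm terms equals
  \<open>t *\<^sub>R S\<close>, which is \<open>mat_max0 G\<close>.\<close>

lemma is_arg_min_quartic_nonneg:
  fixes G :: "real ^ 'r ^ 'm"
  assumes "A \<ge> 0" "t > 0" and t: "t = A * (norm ((1/t) *\<^sub>R mat_max0 G))\<^sup>2 + B"
  shows "is_arg_min (\<lambda>U. (A/4) * norm U ^ 4 + (B/2) * (norm U)\<^sup>2 - G \<bullet> U) (\<lambda>U. 0 \<le> U) U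
    \<longleftrightarrow> U = (1/t) *\<^sub>R mat_max0 G"
proof (rule is_arg_min_iff_quadratic_growth)
  define S where "S = (1/t) *\<^sub>R mat_max0 G"
  have P: "mat_max0 G = t *\<^sub>R S" using \<open>t > 0\<close> by (simp add: S_def)
  show "0 \<le> (1/t) *\<^sub>R mat_max0 G"
    using \<open>t > 0\<close> mat_max0_nonneg[of G] by (simp add: nonneg_iff_entrywise)
  show "t/2 > 0" using \<open>t > 0\<close> by simp
  fix W :: "real ^ 'r ^ 'm"
  assume "0 \<le> W"
  define x y where "x = (norm W)\<^sup>2" and "y = (norm S)\<^sup>2"
  have GW: "G \<bullet> W \<le> t * (S \<bullet> W)"
    using inner_le_inner_mat_max0[OF \<open>0 \<le> W\<close>, of G] by (simp add: P)
  have GS: "G \<bullet> S = t * y"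
    using inner_mat_max0_self[of G] \<open>t > 0\<close> by (simp add: P y_def power2_norm_eq_inner)
  have WS: "(norm (W - S))\<^sup>2 = x - 2 * (S \<bullet> W) + y"
    by (simp add: x_def y_def power2_norm_eq_inner inner_diff_left inner_diff_right inner_commute)
  have "A * (x - y)\<^sup>2 \<ge> 0" using \<open>A \<ge> 0\<close> by simp
  then have "2 * (A * (x * y)) \<le> A * x\<^sup>2 + A * y\<^sup>2"
    by (simp add: power2_eq_square algebra_simps)
  \<comment> \<open>Multiplying \<open>t = A * y + B\<close> by \<open>x\<close> and by
    \<open>y\<close> lets \<open>B\<close> be eliminated by linear arithmetic, with the products as
    atoms.\<close>
  moreover have "t * x = A * (x * y) + B * x" "t * y = A * y\<^sup>2 + B * y"
    using arg_cong[OF t, of "\<lambda>c. c * x"] arg_cong[OF t, of "\<lambda>c. c * y"]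
    unfolding S_def[symmetric] y_def[symmetric] by (simp_all add: power2_eq_square algebra_simps)
  moreover have "t/2 * (norm (W - S))\<^sup>2 = (t * x - 2 * (t * (S \<bullet> W)) + t * y) / 2"
    unfolding WS by (simp add: algebra_simps)
  moreover have "norm W ^ 4 = x\<^sup>2" "norm S ^ 4 = y\<^sup>2"
    by (simp_all add: x_def y_def)
  \<comment> \<open>The right side exceeds the left by
    \<open>(A/4) * (x - y)^2 + (t * (S \<bullet> W) - G \<bullet> W)\<close>, and both summands are
    nonnegative.\<close>
  ultimately have "(A/4) * norm S ^ 4 + (B/2) * (norm S)\<^sup>2 - G \<bullet> S + t/2 * (norm (W - S))\<^sup>2
      \<le> (A/4) * norm W ^ 4 + (B/2) * (norm W)\<^sup>2 - G \<bullet> W"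
    using GW GS unfolding x_def[symmetric] y_def[symmetric] by (simp add: add_divide_distrib diff_divide_distrib)
  then show "(A/4) * norm ((1/t) *\<^sub>R mat_max0 G) ^ 4 + (B/2) * (norm ((1/t) *\<^sub>R mat_max0 G))\<^sup>2
      - G \<bullet> ((1/t) *\<^sub>R mat_max0 G) + t/2 * (norm (W - (1/t) *\<^sub>R mat_max0 G))\<^sup>2
      \<le> (A/4) * norm W ^ 4 + (B/2) * (norm W)\<^sup>2 - G \<bullet> W"
    unfolding S_def .
qed

text \<open>The linear term, the inertial term and the linear part of the Bregman distance merge
  into a single linear functional. The rest is constant in \<open>U\<close>, so
  \<open>is_arg_min_affine\<close> applies with factor \<open>1/\<gamma>\<close>.\<close>

lemma subproblemU_eq:
  assumes "\<gamma> > 0"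
  shows "subproblemU f h \<gamma> \<alpha> Uk Up Vk U =
    (1/\<gamma>) * (h U Vk - (gradU h Uk Vk - \<gamma> *\<^sub>R gradU f Uk Vk + \<alpha> *\<^sub>R (Uk - Up)) \<bullet> U)
    + (1/\<gamma>) * ((gradU h Uk Vk - \<gamma> *\<^sub>R gradU f Uk Vk + \<alpha> *\<^sub>R (Uk - Up)) \<bullet> Uk - h Uk Vk)"
  using assms unfolding subproblemU_def breg_distU_def
  by (simp add: inner_add_left inner_diff_left inner_diff_right field_simps)

lemma subproblemV_eq:
  assumes "\<gamma> > 0"
  shows "subproblemV f h \<gamma> \<alpha> U Vk Vp V =
    (1/\<gamma>) * (h U V - (gradV h U Vk - \<gamma> *\<^sub>R gradV f U Vk + \<alpha> *\<^sub>R (Vk - Vp)) \<bullet> V)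
    + (1/\<gamma>) * ((gradV h U Vk - \<gamma> *\<^sub>R gradV f U Vk + \<alpha> *\<^sub>R (Vk - Vp)) \<bullet> Vk - h U Vk)"
  using assms unfolding subproblemV_def breg_distV_def
  by (simp add: inner_add_left inner_diff_left inner_diff_right field_simps)

text \<open>The equivalences with \<open>is_arg_min\<close> express existence and uniqueness
  together. The \<open>GDERIV\<close> claims identify, through \<open>grad_eqI\<close>, the
  gradients that \<open>gradU\<close> and \<open>gradV\<close> denote. In part (ii),
  \<open>Us\<close> is the minimizer from part (i).\<close>

theorem theorem4p1:
  fixes X :: "real ^ 'm ^ 'm"
    and Uk Up G :: "real ^ 'r ^ 'm"
    and Vk Vp :: "real ^ 'r ^ 'r"
    and a1 b1 a2 \<epsilon>1 \<epsilon>2 \<gamma>1 \<gamma>2 \<alpha>1 \<alpha>2 \<tau>1 \<tau>2 \<Delta>1 t :: real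
    and f h1 h2 :: "real ^ 'r ^ 'm \<Rightarrow> real ^ 'r ^ 'r \<Rightarrow> real"
  assumes "transpose X = X"
    and "a1 > 0" "b1 > 0" "a2 > 0" "\<epsilon>1 > 0" "\<epsilon>2 > 0"
    and "\<gamma>1 > 0" "\<gamma>2 > 0" "\<alpha>1 \<ge> 0" "\<alpha>2 \<ge> 0"
    and f: "f = tri_fact_loss X"
    and h1: "h1 = kernel1 a1 b1 \<epsilon>1 X"
    and h2: "h2 = kernel2 a2 \<epsilon>2"
    and G: "G = gradU h1 Uk Vk - \<gamma>1 *\<^sub>R gradU f Uk Vk + \<alpha>1 *\<^sub>R (Uk - Up)"
    and \<tau>1: "\<tau>1 = b1 * (norm X * norm Vk + \<epsilon>1)"
    and \<tau>2: "\<tau>2 = a1 * (norm Vk)^2 * (norm (mat_max0 G))^2"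
    and \<Delta>1: "\<Delta>1 = \<tau>2^2 + (4/27) * \<tau>2 * \<tau>1^3"
    and t: "t = \<tau>1/3 + root 3 ((\<tau>2 + sqrt \<Delta>1)/2 + \<tau>1^3/27)
                     + root 3 ((\<tau>2 - sqrt \<Delta>1)/2 + \<tau>1^3/27)"
  shows
    "(GDERIV (\<lambda>U. f U Vk) Uk :>
        - (X ** Uk ** transpose Vk) - transpose X ** Uk ** Vk
        + Uk ** Vk ** transpose Uk ** Uk ** transpose Vk
        + Uk ** transpose Vk ** transpose Uk ** Uk ** Vk) \<and>
     (GDERIV (\<lambda>U. h1 U Vk) Uk :>
        (a1 * (norm Uk)^2 * (norm Vk)^2 + b1 * (norm X * norm Vk + \<epsilon>1)) *\<^sub>R Uk) \<and>
     (\<forall>U. is_arg_min (subproblemU f h1 \<gamma>1 \<alpha>1 Uk Up Vk) (\<lambda>U. 0 \<le> U) U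
            \<longleftrightarrow> U = (1/t) *\<^sub>R mat_max0 G) \<and>
     (\<forall>Us. is_arg_min (subproblemU f h1 \<gamma>1 \<alpha>1 Uk Up Vk) (\<lambda>U. 0 \<le> U) Us \<longrightarrow>
        (GDERIV (\<lambda>V. f Us V) Vk :>
           - (transpose Us ** X ** Us)
           + transpose Us ** Us ** Vk ** transpose Us ** Us) \<and>
        (let \<eta> = a2 * ((norm Us)^4 + \<epsilon>2) in
         \<forall>V. is_arg_min (subproblemV f h2 \<gamma>2 \<alpha>2 Us Vk Vp) (\<lambda>V. 0 \<le> V) V
            \<longleftrightarrow> V = mat_max0 (Vk + (1/\<eta>) *\<^sub>R (\<alpha>2 *\<^sub>R (Vk - Vp) - \<gamma>2 *\<^sub>R gradV f Us Vk))))"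
proof (intro conjI allI impI)
  show "GDERIV (\<lambda>U. f U Vk) Uk :>
        - (X ** Uk ** transpose Vk) - transpose X ** Uk ** Vk
        + Uk ** Vk ** transpose Uk ** Uk ** transpose Vk
        + Uk ** transpose Vk ** transpose Uk ** Uk ** Vk"
    unfolding f by (rule GDERIV_tri_fact_loss_U)
  show "GDERIV (\<lambda>U. h1 U Vk) Uk :>
        (a1 * (norm Uk)^2 * (norm Vk)^2 + b1 * (norm X * norm Vk + \<epsilon>1)) *\<^sub>R Uk"
    unfolding h1 by (rule GDERIV_kernel1)
next
  fix U :: "real ^ 'r ^ 'm"
  have "norm X * norm Vk + \<epsilon>1 > 0"
    using \<open>\<epsilon>1 > 0\<close> by (intro add_nonneg_pos) auto
  then have "\<tau>1 > 0" using \<open>b1 > 0\<close> by (simp add: \<tau>1)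
  moreover have "\<tau>2 \<ge> 0" using \<open>a1 > 0\<close> by (simp add: \<tau>2)
  ultimately have "t > 0" and cubic: "t ^ 3 = \<tau>1 * t\<^sup>2 + \<tau>2"
    unfolding t \<Delta>1 by (rule cardano_cubic_root)+
  \<comment> \<open>Dividing the cubic by \<open>t^2\<close> gives the stationarity condition,
    because \<open>\<tau>2 / t^2\<close> carries the squared norm of \<open>mat_max0 G\<close>
    scaled by \<open>1/t\<close>.\<close>
  have "t = \<tau>2 / t\<^sup>2 + \<tau>1"
    using cubic \<open>t > 0\<close> by (simp add: field_simps power2_eq_square power3_eq_cube)
  then have fixpoint: "t = a1 * (norm Vk)\<^sup>2 * (norm ((1/t) *\<^sub>R mat_max0 G))\<^sup>2 + \<tau>1"
    by (simp add: \<tau>2 power_divide)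
  have "is_arg_min (subproblemU f h1 \<gamma>1 \<alpha>1 Uk Up Vk) (\<lambda>U. 0 \<le> U) U \<longleftrightarrow>
      is_arg_min (\<lambda>U. h1 U Vk - G \<bullet> U) (\<lambda>U. 0 \<le> U) U"
    unfolding G
    by (rule is_arg_min_affine[OF subproblemU_eq]) (use \<open>\<gamma>1 > 0\<close> in simp_all)
  also have "\<dots> \<longleftrightarrow> U = (1/t) *\<^sub>R mat_max0 G"
    using is_arg_min_quartic_nonneg[OF _ \<open>t > 0\<close> fixpoint] \<open>a1 > 0\<close>
    by (simp add: h1 kernel1_def \<tau>1 mult_ac)
  finally show "is_arg_min (subproblemU f h1 \<gamma>1 \<alpha>1 Uk Up Vk) (\<lambda>U. 0 \<le> U) U \<longleftrightarrow>
      U = (1/t) *\<^sub>R mat_max0 G" .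
next
  fix Us :: "real ^ 'r ^ 'm"
  show "GDERIV (\<lambda>V. f Us V) Vk :>
      - (transpose Us ** X ** Us) + transpose Us ** Us ** Vk ** transpose Us ** Us"
    unfolding f by (rule GDERIV_tri_fact_loss_V)
  define \<eta> where "\<eta> = a2 * (norm Us ^ 4 + \<epsilon>2)"
  define K where "K = \<alpha>2 *\<^sub>R (Vk - Vp) - \<gamma>2 *\<^sub>R gradV f Us Vk"
  have "norm Us ^ 4 + \<epsilon>2 > 0"
    using \<open>\<epsilon>2 > 0\<close> by (intro add_nonneg_pos) auto
  then have "\<eta> > 0" using \<open>a2 > 0\<close> by (simp add: \<eta>_def)
  have "gradV h2 Us Vk = \<eta> *\<^sub>R Vk"
    unfolding gradV_def h2 \<eta>_def by (rule grad_eqI[OF GDERIV_kernel2])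
  \<comment> \<open>Splitting off \<open>\<eta> *\<^sub>R Vk\<close> makes division by
    \<open>\<eta>\<close> yield a step from \<open>Vk\<close>.\<close>
  then have shift: "gradV h2 Us Vk - \<gamma>2 *\<^sub>R gradV f Us Vk + \<alpha>2 *\<^sub>R (Vk - Vp) = \<eta> *\<^sub>R Vk + K"
    by (simp add: K_def)
  have "is_arg_min (subproblemV f h2 \<gamma>2 \<alpha>2 Us Vk Vp) (\<lambda>V. 0 \<le> V) V \<longleftrightarrow>
      V = mat_max0 (Vk + (1/\<eta>) *\<^sub>R K)" for V
  proof -
    have "is_arg_min (subproblemV f h2 \<gamma>2 \<alpha>2 Us Vk Vp) (\<lambda>V. 0 \<le> V) V \<longleftrightarrow>
        is_arg_min (\<lambda>V. h2 Us V - (\<eta> *\<^sub>R Vk + K) \<bullet> V) (\<lambda>V. 0 \<le> V) V"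
      unfolding shift[symmetric]
      by (rule is_arg_min_affine[OF subproblemV_eq]) (use \<open>\<gamma>2 > 0\<close> in simp_all)
    also have "\<dots> \<longleftrightarrow> V = (1/\<eta>) *\<^sub>R mat_max0 (\<eta> *\<^sub>R Vk + K)"
      \<comment> \<open>With \<open>A = 0\<close> the stationarity condition reads
        \<open>t = B\<close>, so \<open>t = \<eta>\<close> and no cubic arises.\<close>
      using is_arg_min_quartic_nonneg[of 0 \<eta> "\<eta> *\<^sub>R Vk + K" \<eta>] \<open>\<eta> > 0\<close>
      by (simp add: h2 kernel2_def \<eta>_def mult_ac)
    \<comment> \<open>The entrywise maximum with 0 commutes with the positive factor
      \<open>1/\<eta>\<close>.\<close>
    also have "(1/\<eta>) *\<^sub>R mat_max0 (\<eta> *\<^sub>R Vk + K) = mat_max0 (Vk + (1/\<eta>) *\<^sub>R K)"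
      using \<open>\<eta> > 0\<close> by (simp add: mat_max0_scaleR[symmetric] scaleR_add_right)
    finally show ?thesis .
  qed
  then show "let \<eta> = a2 * ((norm Us)^4 + \<epsilon>2) in
      \<forall>V. is_arg_min (subproblemV f h2 \<gamma>2 \<alpha>2 Us Vk Vp) (\<lambda>V. 0 \<le> V) V
        \<longleftrightarrow> V = mat_max0 (Vk + (1/\<eta>) *\<^sub>R (\<alpha>2 *\<^sub>R (Vk - Vp) - \<gamma>2 *\<^sub>R gradV f Us Vk))"
    by (simp add: Let_def \<eta>_def K_def)
qed

end
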